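(* Let $M$ be a monoid and let $\mathcal{C}(M)$ be the space of congruence relations on $M$. Then the set of congruence relations $\gamma$ on $M$ such that the quotient monoid $M/\gamma$ is surjunctive is closed in $\mathcal{C}(M)$.
   Context: A congruence relation on a monoid $M$ is an equivalence relation $\gamma\subset M\times M$ such that $(m_1,m_1'),(m_2,m_2')\in\gamma$ implies $(m_1m_2,m_1'm_2')\in\gamma$; the quotient set $M/\gamma$ is then a monoid with $[m][m']=[mm']$. The set $\mathcal{C}(M)$ of all congruence relations on $M$ is viewed as a subset of $\mathcal{P}(M\times M)=\{0,1\}^{M\times M}$ and is equipped with the topology (and uniform structure) induced by the product of the discrete topologies (uniform structures); a base of entourages consists of the sets $\{(\gamma_1,\gamma_2)\in\mathcal{C}(M)\times\mathcal{C}(M):\gamma_1\cap F=\gamma_2\cap F\}$, $F$ running over the finite subsets of $M\times M$. Let $N$ be a monoid and $A$ a set. The set $A^N$ of all maps $x\colon N\to A$ carries the shift action of $N$ given by $(nx)(n') := x(n'n)$ for $n,n'\in N$, and the prodiscrete uniform structure, for which a base of entourages is given by the sets $W_F := \{(x,y)\in A^N\times A^N : x|_F = y|_F\}$, $F$ running over all finite subsets of $N$. A cellular automaton over $N$ with alphabet $A$ is a map $\tau\colon A^N\to A^N$ that is $N$-equivariant ($\tau(nx)=n\tau(x)$ for all $n\in N$, $x\in A^N$) and uniformly continuous. The monoid $N$ is called surjunctive if, for every finite set $A$, every injective cellular automaton $\tau\colon A^N\to A^N$ is surjective. *)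

theory Defs
  imports "HOL-Algebra.Group" "HOL-Analysis.Function_Topology"
begin

section \<open>Congruence relations and quotient monoids\<close>

definition congruence_on :: "('a, 'b) monoid_scheme \<Rightarrow> 'a rel \<Rightarrow> bool" where
  "congruence_on M \<gamma> \<longleftrightarrow>
     equiv (carrier M) \<gamma> \<and>
     (\<forall>m1 m1' m2 m2'. (m1, m1') \<in> \<gamma> \<longrightarrow> (m2, m2') \<in> \<gamma> \<longrightarrow>
        (m1 \<otimes>\<^bsub>M\<^esub> m2, m1' \<otimes>\<^bsub>M\<^esub> m2') \<in> \<gamma>)"

definition congruences :: "('a, 'b) monoid_scheme \<Rightarrow> 'a rel set" where
  "congruences M = {\<gamma>. congruence_on M \<gamma>}"

text \<open>The union in the multiplication is the usual way of writing an operation on classes without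
  choosing representatives: for a congruence all the classes in the union coincide.\<close>

definition quotient_monoid :: "('a, 'b) monoid_scheme \<Rightarrow> 'a rel \<Rightarrow> 'a set monoid" where
  "quotient_monoid M \<gamma> =
     \<lparr>carrier = carrier M // \<gamma>,
      mult = (\<lambda>X Y. \<Union>x\<in>X. \<Union>y\<in>Y. \<gamma> `` {x \<otimes>\<^bsub>M\<^esub> y}),
      one = \<gamma> `` {\<one>\<^bsub>M\<^esub>}\<rparr>"

lemma quotient_monoid_mult:
  assumes "congruence_on M \<gamma>" and "m \<in> carrier M" and "m' \<in> carrier M"
  shows "\<gamma> `` {m} \<otimes>\<^bsub>quotient_monoid M \<gamma>\<^esub> \<gamma> `` {m'} = \<gamma> `` {m \<otimes>\<^bsub>M\<^esub> m'}"
proof -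
  have eq: "equiv (carrier M) \<gamma>"
    using assms(1) by (simp add: congruence_on_def)
  have "congruent2 \<gamma> \<gamma> (\<lambda>x y. \<gamma> `` {x \<otimes>\<^bsub>M\<^esub> y})"
  proof (rule congruent2I')
    fix y1 z1 y2 z2 assume "(y1, z1) \<in> \<gamma>" "(y2, z2) \<in> \<gamma>"
    then have "(y1 \<otimes>\<^bsub>M\<^esub> y2, z1 \<otimes>\<^bsub>M\<^esub> z2) \<in> \<gamma>"
      using assms(1) by (simp add: congruence_on_def)
    then show "\<gamma> `` {y1 \<otimes>\<^bsub>M\<^esub> y2} = \<gamma> `` {z1 \<otimes>\<^bsub>M\<^esub> z2}"
      by (rule equiv_class_eq[OF eq])
  qed
  from UN_equiv_class2[OF eq eq this assms(2,3)] show ?thesis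
    by (simp add: quotient_monoid_def)
qed

lemma monoid_quotient_monoid:
  assumes "monoid M" and "congruence_on M \<gamma>"
  shows "monoid (quotient_monoid M \<gamma>)"
proof -
  interpret monoid M by fact
  let ?Q = "quotient_monoid M \<gamma>"
  note mult = quotient_monoid_mult[OF assms(2)]
  have one: "\<one>\<^bsub>?Q\<^esub> = \<gamma> `` {\<one>\<^bsub>M\<^esub>}"
    by (simp add: quotient_monoid_def)
  have cls: "\<gamma> `` {m} \<in> carrier ?Q" if "m \<in> carrier M" for m
    using that by (simp add: quotient_monoid_def quotientI)
  have rep: "\<exists>m\<in>carrier M. X = \<gamma> `` {m}" if "X \<in> carrier ?Q" for X
    using that by (auto simp: quotient_monoid_def quotient_def)
  show ?thesis
  proof (rule monoidI)
    fix X Y assume "X \<in> carrier ?Q" "Y \<in> carrier ?Q"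
    from this[THEN rep] show "X \<otimes>\<^bsub>?Q\<^esub> Y \<in> carrier ?Q"
      by (elim bexE) (simp only: mult cls m_closed)
  next
    show "\<one>\<^bsub>?Q\<^esub> \<in> carrier ?Q"
      by (simp only: one cls one_closed)
  next
    fix X Y Z assume "X \<in> carrier ?Q" "Y \<in> carrier ?Q" "Z \<in> carrier ?Q"
    from this[THEN rep] show "X \<otimes>\<^bsub>?Q\<^esub> Y \<otimes>\<^bsub>?Q\<^esub> Z = X \<otimes>\<^bsub>?Q\<^esub> (Y \<otimes>\<^bsub>?Q\<^esub> Z)"
      by (elim bexE) (simp only: mult m_closed m_assoc)
  next
    fix X assume "X \<in> carrier ?Q"
    from rep[OF this] show "\<one>\<^bsub>?Q\<^esub> \<otimes>\<^bsub>?Q\<^esub> X = X"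
      by (elim bexE) (simp only: one mult one_closed l_one)
  next
    fix X assume "X \<in> carrier ?Q"
    from rep[OF this] show "X \<otimes>\<^bsub>?Q\<^esub> \<one>\<^bsub>?Q\<^esub> = X"
      by (elim bexE) (simp only: one mult one_closed r_one)
  qed
qed

section \<open>The space of congruence relations\<close>

text \<open>A congruence is identified with its indicator function on \<open>carrier M \<times> carrier M\<close>, and the
  product topology on functions into the discrete two-point space is pulled back along this
  identification.\<close>

definition congruence_space :: "('a, 'b) monoid_scheme \<Rightarrow> 'a rel topology" where
  "congruence_space M =
     pullback_topology (congruences M)
       (\<lambda>\<gamma>. \<lambda>p\<in>carrier M \<times> carrier M. p \<in> \<gamma>)
       (product_topology (\<lambda>_. discrete_topology (UNIV :: bool set)) (carrier M \<times> carrier M))"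

lemma topspace_congruence_space: "topspace (congruence_space M) = congruences M"
  by (auto simp: congruence_space_def topspace_pullback_topology)

lemma openin_congruence_space:
  "openin (congruence_space M) S \<longleftrightarrow>
     S \<subseteq> congruences M \<and>
     (\<forall>\<gamma>\<in>S. \<exists>F. finite F \<and> F \<subseteq> carrier M \<times> carrier M \<and>
        (\<forall>\<delta>\<in>congruences M. \<gamma> \<inter> F = \<delta> \<inter> F \<longrightarrow> \<delta> \<in> S))" (is "?L \<longleftrightarrow> ?R")
proof
  let ?I = "carrier M \<times> carrier M"
  let ?T = "product_topology (\<lambda>_. discrete_topology (UNIV :: bool set)) ?I"
  let ?c = "\<lambda>\<gamma>. \<lambda>p\<in>?I. p \<in> \<gamma>"
  {
    assume ?L
    then obtain U where U: "openin ?T U" "S = ?c -` U \<inter> congruences M"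
      by (auto simp: congruence_space_def openin_pullback_topology)
    show ?R
    proof (intro conjI ballI)
      fix \<gamma> assume "\<gamma> \<in> S"
      then have "?c \<gamma> \<in> U" using U by auto
      with U(1) obtain V where V: "finite {i \<in> ?I. V i \<noteq> (UNIV :: bool set)}"
        "?c \<gamma> \<in> Pi\<^sub>E ?I V" "Pi\<^sub>E ?I V \<subseteq> U"
        unfolding openin_product_topology_alt topspace_discrete_topology by blast
      define F where "F = {i \<in> ?I. V i \<noteq> UNIV}"
      have "\<delta> \<in> S" if \<delta>: "\<delta> \<in> congruences M" "\<gamma> \<inter> F = \<delta> \<inter> F" for \<delta>
      proof -
        have "?c \<delta> i \<in> V i" if i: "i \<in> ?I" for i
        proof (cases "i \<in> F")
          case True
          then have "(i \<in> \<gamma>) = (i \<in> \<delta>)" using \<delta>(2) by blast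
          moreover have "?c \<gamma> i \<in> V i" using V(2) i by (rule PiE_mem)
          ultimately show ?thesis using i by (simp only: restrict_apply')
        next
          case False
          then have "V i = UNIV" using i unfolding F_def by blast
          then show ?thesis by simp
        qed
        then have "?c \<delta> \<in> Pi\<^sub>E ?I V" by (simp only: PiE_iff restrict_extensional) blast
        then show ?thesis using U(2) V(3) \<delta>(1) by blast
      qed
      then show "\<exists>F. finite F \<and> F \<subseteq> ?I \<and>
          (\<forall>\<delta>\<in>congruences M. \<gamma> \<inter> F = \<delta> \<inter> F \<longrightarrow> \<delta> \<in> S)"
        using V(1) unfolding F_def[symmetric] by (intro exI[of _ F]) (auto simp: F_def)
    qed (use U in blast)
  next
    assume R: ?R
    define W where "W F \<gamma> = Pi\<^sub>E ?I (\<lambda>i. if i \<in> F then {i \<in> \<gamma>} else UNIV)" for F and \<gamma> :: "'a rel"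
    have W: "?c \<delta> \<in> W F \<gamma> \<longleftrightarrow> \<gamma> \<inter> F = \<delta> \<inter> F" if "F \<subseteq> ?I" for F \<gamma> \<delta>
    proof -
      have "?c \<delta> \<in> W F \<gamma> \<longleftrightarrow> (\<forall>i\<in>F. (i \<in> \<delta>) = (i \<in> \<gamma>))"
        using that unfolding W_def PiE_iff by (fastforce split: if_splits)
      then show ?thesis by blast
    qed
    have oW: "openin ?T (W F \<gamma>)" if "finite F" for F \<gamma>
      unfolding W_def
      by (subst openin_PiE_gen) (auto intro: finite_subset[OF _ that] split: if_splits)
    from R obtain F where F: "\<And>\<gamma>. \<gamma> \<in> S \<Longrightarrow> finite (F \<gamma>) \<and> F \<gamma> \<subseteq> ?I \<and>
        (\<forall>\<delta>\<in>congruences M. \<gamma> \<inter> F \<gamma> = \<delta> \<inter> F \<gamma> \<longrightarrow> \<delta> \<in> S)"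
      by metis
    have "openin ?T (\<Union>\<gamma>\<in>S. W (F \<gamma>) \<gamma>)"
      by (intro openin_Union ballI) (auto intro!: oW dest: F)
    moreover have "S = ?c -` (\<Union>\<gamma>\<in>S. W (F \<gamma>) \<gamma>) \<inter> congruences M"
    proof (intro equalityI subsetI)
      fix \<gamma> assume "\<gamma> \<in> S"
      then show "\<gamma> \<in> ?c -` (\<Union>\<gamma>\<in>S. W (F \<gamma>) \<gamma>) \<inter> congruences M"
        using R F[of \<gamma>] W[of "F \<gamma>" \<gamma> \<gamma>] by auto
    next
      fix \<delta> assume "\<delta> \<in> ?c -` (\<Union>\<gamma>\<in>S. W (F \<gamma>) \<gamma>) \<inter> congruences M"
      then obtain \<gamma> where "\<gamma> \<in> S" "?c \<delta> \<in> W (F \<gamma>) \<gamma>" "\<delta> \<in> congruences M"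
        by auto
      then show "\<delta> \<in> S" using F[of \<gamma>] W[of "F \<gamma>" \<delta> \<gamma>] by auto
    qed
    ultimately show ?L
      unfolding congruence_space_def openin_pullback_topology by (intro exI conjI)
  }
qed

section \<open>Cellular automata and surjunctive monoids\<close>

definition configs :: "('n, 'b) monoid_scheme \<Rightarrow> 'c set \<Rightarrow> ('n \<Rightarrow> 'c) set" where
  "configs N A = (carrier N \<rightarrow>\<^sub>E A)"

definition shift :: "('n, 'b) monoid_scheme \<Rightarrow> 'n \<Rightarrow> ('n \<Rightarrow> 'c) \<Rightarrow> ('n \<Rightarrow> 'c)" where
  "shift N n x = (\<lambda>n'\<in>carrier N. x (n' \<otimes>\<^bsub>N\<^esub> n))"

definition prodiscrete_entourage ::
    "('n, 'b) monoid_scheme \<Rightarrow> 'c set \<Rightarrow> 'n set \<Rightarrow> (('n \<Rightarrow> 'c) \<times> ('n \<Rightarrow> 'c)) set" where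
  "prodiscrete_entourage N A F =
     {(x, y) \<in> configs N A \<times> configs N A. restrict x F = restrict y F}"

definition prodiscrete_uniformity ::
    "('n, 'b) monoid_scheme \<Rightarrow> 'c set \<Rightarrow> (('n \<Rightarrow> 'c) \<times> ('n \<Rightarrow> 'c)) filter" where
  "prodiscrete_uniformity N A =
     (INF F\<in>{F. finite F \<and> F \<subseteq> carrier N}. principal (prodiscrete_entourage N A F))"

text \<open>Uniform continuity is phrased with filters as in the type class \<open>uniform_space\<close>, which is not
  applicable itself because the configuration space is a proper subset of its type.\<close>

definition cellular_automaton ::
    "('n, 'b) monoid_scheme \<Rightarrow> 'c set \<Rightarrow> (('n \<Rightarrow> 'c) \<Rightarrow> ('n \<Rightarrow> 'c)) \<Rightarrow> bool" where
  "cellular_automaton N A \<tau> \<longleftrightarrow>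
     \<tau> \<in> configs N A \<rightarrow> configs N A \<and>
     (\<forall>n\<in>carrier N. \<forall>x\<in>configs N A. \<tau> (shift N n x) = shift N n (\<tau> x)) \<and>
     filterlim (\<lambda>(x, y). (\<tau> x, \<tau> y)) (prodiscrete_uniformity N A) (prodiscrete_uniformity N A)"

text \<open>A definition cannot quantify over the type of the alphabet. Finite subsets of the naturals
  represent all finite sets up to bijection; the lemma \<open>surjunctiveD\<close> below recovers the property
  for finite alphabets of every type.\<close>

definition surjunctive :: "('n, 'b) monoid_scheme \<Rightarrow> bool" where
  "surjunctive N \<longleftrightarrow>
     (\<forall>A :: nat set. finite A \<longrightarrow>
        (\<forall>\<tau>. cellular_automaton N A \<tau> \<longrightarrow> inj_on \<tau> (configs N A) \<longrightarrow>
              \<tau> ` configs N A = configs N A))"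

lemma eventually_prodiscrete_uniformity:
  "eventually P (prodiscrete_uniformity N A) \<longleftrightarrow>
     (\<exists>F. finite F \<and> F \<subseteq> carrier N \<and> (\<forall>p\<in>prodiscrete_entourage N A F. P p))"
proof -
  have anti: "prodiscrete_entourage N A G \<subseteq> prodiscrete_entourage N A F" if "F \<subseteq> G" for F G
    using that unfolding prodiscrete_entourage_def by (auto simp: fun_eq_iff restrict_def)
  show ?thesis
    unfolding prodiscrete_uniformity_def
  proof (subst eventually_INF_base)
    show "{F. finite F \<and> F \<subseteq> carrier N} \<noteq> {}" by blast
  next
    fix F G assume "F \<in> {F. finite F \<and> F \<subseteq> carrier N}" "G \<in> {F. finite F \<and> F \<subseteq> carrier N}"
    then show "\<exists>H\<in>{F. finite F \<and> F \<subseteq> carrier N}. principal (prodiscrete_entourage N A H) \<le>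
        inf (principal (prodiscrete_entourage N A F)) (principal (prodiscrete_entourage N A G))"
      by (intro bexI[of _ "F \<union> G"]) (simp_all add: anti)
  qed (auto simp: eventually_principal)
qed

lemma uniformly_continuous_prodiscrete_iff:
  assumes "\<tau> \<in> configs N A \<rightarrow> configs N B"
  shows "filterlim (\<lambda>(x, y). (\<tau> x, \<tau> y)) (prodiscrete_uniformity N B) (prodiscrete_uniformity N A)
    \<longleftrightarrow> (\<forall>F. finite F \<and> F \<subseteq> carrier N \<longrightarrow> (\<exists>E. finite E \<and> E \<subseteq> carrier N \<and>
          (\<forall>x\<in>configs N A. \<forall>y\<in>configs N A.
             (\<forall>n\<in>E. x n = y n) \<longrightarrow> (\<forall>n\<in>F. \<tau> x n = \<tau> y n))))"
proof -
  have r: "restrict x F = restrict y F \<longleftrightarrow> (\<forall>n\<in>F. x n = y n)"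
    for x y :: "'x \<Rightarrow> 'y" and F
    by (auto simp: fun_eq_iff restrict_def)
  have "filterlim (\<lambda>(x, y). (\<tau> x, \<tau> y)) (prodiscrete_uniformity N B) (prodiscrete_uniformity N A)
    \<longleftrightarrow> (\<forall>F\<in>{F. finite F \<and> F \<subseteq> carrier N}. eventually
          (\<lambda>(x, y). (\<tau> x, \<tau> y) \<in> prodiscrete_entourage N B F) (prodiscrete_uniformity N A))"
    unfolding prodiscrete_uniformity_def[of N B]
    by (simp add: filterlim_INF filterlim_principal case_prod_unfold)
  moreover have "(\<forall>p\<in>prodiscrete_entourage N A E.
        case p of (x, y) \<Rightarrow> (\<tau> x, \<tau> y) \<in> prodiscrete_entourage N B F) \<longleftrightarrow>
      (\<forall>x\<in>configs N A. \<forall>y\<in>configs N A.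
         (\<forall>n\<in>E. x n = y n) \<longrightarrow> (\<forall>n\<in>F. \<tau> x n = \<tau> y n))" for E F
    using assms by (auto simp: prodiscrete_entourage_def r Pi_iff)
  ultimately show ?thesis
    unfolding eventually_prodiscrete_uniformity by simp
qed

lemma surjunctiveD:
  fixes A :: "'c set"
  assumes N: "monoid N" and surj: "surjunctive N" and fin: "finite A"
    and ca: "cellular_automaton N A \<tau>" and inj: "inj_on \<tau> (configs N A)"
  shows "\<tau> ` configs N A = configs N A"
proof -
  interpret monoid N by fact
  obtain f :: "'c \<Rightarrow> nat" where f: "inj_on f A"
    using finite_imp_inj_to_nat_seg[OF fin] by auto
  define B where "B = f ` A"
  define g where "g = inv_into A f"
  have gf: "g (f a) = a" if "a \<in> A" for a
    using that f by (simp add: g_def)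
  have fg: "f (g b) = b" "g b \<in> A" if "b \<in> B" for b
    using that by (auto simp: g_def B_def f_inv_into_f inv_into_into)
  define \<phi> where "\<phi> x = (\<lambda>n\<in>carrier N. f (x n))" for x :: "'a \<Rightarrow> 'c"
  define \<psi> where "\<psi> y = (\<lambda>n\<in>carrier N. g (y n))" for y :: "'a \<Rightarrow> nat"
  have \<phi>: "\<phi> x \<in> configs N B" if "x \<in> configs N A" for x
    using that by (auto simp: \<phi>_def configs_def B_def)
  have \<psi>: "\<psi> y \<in> configs N A" if "y \<in> configs N B" for y
    using that fg by (auto simp: \<psi>_def configs_def)
  have \<psi>\<phi>: "\<psi> (\<phi> x) = x" if "x \<in> configs N A" for x
    using that gf by (auto simp: \<phi>_def \<psi>_def configs_def fun_eq_iff PiE_iff extensional_def)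
  have \<phi>\<psi>: "\<phi> (\<psi> y) = y" if "y \<in> configs N B" for y
    using that fg by (auto simp: \<phi>_def \<psi>_def configs_def fun_eq_iff PiE_iff extensional_def)
  have s\<phi>: "\<phi> (shift N n x) = shift N n (\<phi> x)" if "n \<in> carrier N" for n x
    using that by (auto simp: \<phi>_def shift_def fun_eq_iff)
  have s\<psi>: "\<psi> (shift N n x) = shift N n (\<psi> x)" if "n \<in> carrier N" for n x
    using that by (auto simp: \<psi>_def shift_def fun_eq_iff)
  have \<tau>: "\<tau> x \<in> configs N A" if "x \<in> configs N A" for x
    using ca that by (auto simp: cellular_automaton_def)
  define \<sigma> where "\<sigma> y = \<phi> (\<tau> (\<psi> y))" for y
  have \<sigma>: "\<sigma> \<in> configs N B \<rightarrow> configs N B"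
    using \<phi> \<psi> \<tau> by (auto simp: \<sigma>_def)
  have "\<sigma> (shift N n y) = shift N n (\<sigma> y)" if "n \<in> carrier N" "y \<in> configs N B" for n y
    using that ca \<psi>[of y] by (simp add: \<sigma>_def s\<phi> s\<psi> cellular_automaton_def)
  moreover have "filterlim (\<lambda>(x, y). (\<sigma> x, \<sigma> y))
      (prodiscrete_uniformity N B) (prodiscrete_uniformity N B)"
    unfolding uniformly_continuous_prodiscrete_iff[OF \<sigma>]
  proof (intro allI impI)
    fix F assume F: "finite F \<and> F \<subseteq> carrier N"
    have "\<tau> \<in> configs N A \<rightarrow> configs N A" using \<tau> by blast
    from uniformly_continuous_prodiscrete_iff[OF this] ca
    have "\<forall>F. finite F \<and> F \<subseteq> carrier N \<longrightarrow> (\<exists>E. finite E \<and> E \<subseteq> carrier N \<and>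
        (\<forall>x\<in>configs N A. \<forall>y\<in>configs N A.
           (\<forall>n\<in>E. x n = y n) \<longrightarrow> (\<forall>n\<in>F. \<tau> x n = \<tau> y n)))"
      unfolding cellular_automaton_def by (elim conjE) (rule iffD1)
    from this[rule_format, OF F] obtain E where E: "finite E" "E \<subseteq> carrier N"
      and EF: "\<forall>x\<in>configs N A. \<forall>y\<in>configs N A.
           (\<forall>n\<in>E. x n = y n) \<longrightarrow> (\<forall>n\<in>F. \<tau> x n = \<tau> y n)"
      by (elim exE conjE)
    have "\<forall>n\<in>F. \<sigma> x n = \<sigma> y n"
      if xy: "x \<in> configs N B" "y \<in> configs N B" "\<forall>n\<in>E. x n = y n" for x y
    proof -
      have "\<forall>n\<in>E. \<psi> x n = \<psi> y n" using xy(3) by (simp add: \<psi>_def restrict_def)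
      then have "\<forall>n\<in>F. \<tau> (\<psi> x) n = \<tau> (\<psi> y) n"
        by (rule EF[THEN bspec, OF \<psi>[OF xy(1)], THEN bspec, OF \<psi>[OF xy(2)], THEN mp])
      then show ?thesis by (simp add: \<sigma>_def \<phi>_def restrict_def)
    qed
    note * = this
    show "\<exists>E. finite E \<and> E \<subseteq> carrier N \<and> (\<forall>x\<in>configs N B. \<forall>y\<in>configs N B.
        (\<forall>n\<in>E. x n = y n) \<longrightarrow> (\<forall>n\<in>F. \<sigma> x n = \<sigma> y n))"
      by (intro exI[of _ E] conjI E) (intro ballI impI, rule *[THEN bspec])
  qed
  ultimately have "cellular_automaton N B \<sigma>"
    using \<sigma> by (simp add: cellular_automaton_def)
  moreover have "inj_on \<sigma> (configs N B)"
  proof (rule inj_onI)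
    fix x y assume xy: "x \<in> configs N B" "y \<in> configs N B" "\<sigma> x = \<sigma> y"
    then have "\<tau> (\<psi> x) = \<tau> (\<psi> y)" unfolding \<sigma>_def by (metis \<psi>\<phi> \<tau> \<psi>)
    then have "\<psi> x = \<psi> y" using inj \<psi> xy by (meson inj_onD)
    then show "x = y" using \<phi>\<psi> xy by metis
  qed
  moreover have "finite B" using fin by (simp add: B_def)
  ultimately have *: "\<sigma> ` configs N B = configs N B"
    using surj unfolding surjunctive_def by blast
  show ?thesis
  proof (intro equalityI subsetI)
    fix x assume x: "x \<in> configs N A"
    then obtain y where "y \<in> configs N B" "\<phi> x = \<sigma> y" using * \<phi> by blast
    then have "x = \<tau> (\<psi> y)" unfolding \<sigma>_def by (metis \<psi>\<phi> \<tau> \<psi> x)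
    then show "x \<in> \<tau> ` configs N A" using \<psi> \<open>y \<in> configs N B\<close> by blast
  qed (use \<tau> in blast)
qed

end

theory Submission
  imports Defs "HOL-Algebra.Coset" "HOL-Analysis.T1_Spaces"
begin

text \<open>By compactness, an injective cellular automaton \<open>\<tau>\<close> with finite alphabet has a left inverse
  \<open>\<sigma>\<close> given by a finite local rule, and \<open>\<tau>\<close> is surjective iff \<open>\<tau> \<circ> \<sigma> = id\<close>. Failure of
  surjunctivity is thus witnessed by two local rules with \<open>\<sigma> \<circ> \<tau> = id\<close> but \<open>\<tau> \<circ> \<sigma> \<noteq> id\<close>. By
  equivariance both conditions need only be tested at the identity, where they involve finitely many
  products of memory elements. Hence for \<open>M / \<gamma>\<close> they depend only on the restriction of \<open>\<gamma>\<close> to a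
  finite set, and failure of surjunctivity is an open condition.\<close>

section \<open>Functions of finitely many coordinates\<close>

definition determined_by :: "'i set \<Rightarrow> ('i \<Rightarrow> 'c) set \<Rightarrow> (('i \<Rightarrow> 'c) \<Rightarrow> 'd) \<Rightarrow> bool" where
  "determined_by T X v \<longleftrightarrow> (\<forall>x\<in>X. \<forall>y\<in>X. (\<forall>t\<in>T. x t = y t) \<longrightarrow> v x = v y)"

lemma determined_byI:
  "(\<And>x y. \<lbrakk>x \<in> X; y \<in> X; \<And>t. t \<in> T \<Longrightarrow> x t = y t\<rbrakk> \<Longrightarrow> v x = v y) \<Longrightarrow> determined_by T X v"
  unfolding determined_by_def by blast

lemma determined_byD:
  "\<lbrakk>determined_by T X v; x \<in> X; y \<in> X; \<And>t. t \<in> T \<Longrightarrow> x t = y t\<rbrakk> \<Longrightarrow> v x = v y"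
  unfolding determined_by_def by blast

lemma determined_by_cong:
  "(\<And>x. x \<in> X \<Longrightarrow> v x = w x) \<Longrightarrow> determined_by T X v \<longleftrightarrow> determined_by T X w"
  by (simp only: determined_by_def cong: ball_cong)

lemma determined_by_factorization:
  assumes det: "determined_by T X v" and T: "finite T" "T \<subseteq> h ` C"
    and v: "v \<in> X \<rightarrow> A" and A: "A \<noteq> {}"
  obtains S \<mu> where "finite S" "S \<subseteq> C" "\<mu> \<in> (S \<rightarrow>\<^sub>E A) \<rightarrow> A"
    "\<And>x. x \<in> X \<Longrightarrow> v x = \<mu> (\<lambda>s\<in>S. x (h s))"
proof -
  obtain S where S: "finite S" "S \<subseteq> C" "T = h ` S"
    using finite_subset_image[OF T] by blast
  have "v x = v y" if "x \<in> X" "y \<in> X" "(\<lambda>s\<in>S. x (h s)) = (\<lambda>s\<in>S. y (h s))" for x y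
  proof (rule determined_byD[OF det that(1,2)])
    fix t assume "t \<in> T"
    then show "x t = y t" using S(3) that(3) by (metis imageE restrict_apply')
  qed
  then obtain \<kappa> where \<kappa>: "\<And>x. x \<in> X \<Longrightarrow> v x = \<kappa> (\<lambda>s\<in>S. x (h s))"
    using function_factors_left_gen[of "\<lambda>x. x \<in> X" "\<lambda>x. \<lambda>s\<in>S. x (h s)" v] by blast
  obtain a where a: "a \<in> A" using A by blast
  define \<mu> where "\<mu> p = (if \<kappa> p \<in> A then \<kappa> p else a)" for p
  show ?thesis
  proof (rule that[OF S(1,2)])
    show "\<mu> \<in> (S \<rightarrow>\<^sub>E A) \<rightarrow> A" using a by (simp add: \<mu>_def)
    show "v x = \<mu> (\<lambda>s\<in>S. x (h s))" if "x \<in> X" for x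
      using \<kappa>[OF that] funcset_mem[OF v that] by (simp add: \<mu>_def)
  qed
qed

section \<open>Continuity and compactness in prodiscrete spaces\<close>

abbreviation prodiscrete :: "'i set \<Rightarrow> 'c set \<Rightarrow> ('i \<Rightarrow> 'c) topology" where
  "prodiscrete I A \<equiv> product_topology (\<lambda>_. discrete_topology A) I"

definition cylinder :: "'i set \<Rightarrow> 'c set \<Rightarrow> 'i set \<Rightarrow> ('i \<Rightarrow> 'c) \<Rightarrow> ('i \<Rightarrow> 'c) set" where
  "cylinder I A F x = {y \<in> I \<rightarrow>\<^sub>E A. \<forall>i\<in>F. y i = x i}"

lemma openin_cylinder:
  assumes "finite F" "F \<subseteq> I"
  shows "openin (prodiscrete I A) (cylinder I A F x)"
proof -
  have "cylinder I A F x = Pi\<^sub>E I (\<lambda>i. if i \<in> F then A \<inter> {x i} else A)"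
    using assms(2) unfolding cylinder_def PiE_iff set_eq_iff by (auto split: if_splits)
  then show ?thesis
    by (simp add: openin_PiE_gen) (auto intro: finite_subset[OF _ assms(1)])
qed

lemma openin_prodiscrete_iff:
  "openin (prodiscrete I A) U \<longleftrightarrow>
     U \<subseteq> I \<rightarrow>\<^sub>E A \<and> (\<forall>x\<in>U. \<exists>F. finite F \<and> F \<subseteq> I \<and> cylinder I A F x \<subseteq> U)"
    (is "?L \<longleftrightarrow> ?R")
proof
  assume U: ?L
  show ?R
  proof (intro conjI ballI)
    show "U \<subseteq> I \<rightarrow>\<^sub>E A" using openin_subset[OF U] by simp
  next
    fix x assume "x \<in> U"
    with U obtain V where V: "finite {i \<in> I. V i \<noteq> A}" "x \<in> Pi\<^sub>E I V" "Pi\<^sub>E I V \<subseteq> U"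
      unfolding openin_product_topology_alt by auto
    have "cylinder I A {i \<in> I. V i \<noteq> A} x \<subseteq> Pi\<^sub>E I V"
    proof (intro subsetI PiE_I)
      fix y i assume y: "y \<in> cylinder I A {i \<in> I. V i \<noteq> A} x"
      show "y i \<in> V i" if "i \<in> I"
        using y V(2) that by (cases "V i = A") (auto simp: cylinder_def PiE_iff)
      show "y i = undefined" if "i \<notin> I"
        using y that by (auto simp: cylinder_def)
    qed
    then show "\<exists>F. finite F \<and> F \<subseteq> I \<and> cylinder I A F x \<subseteq> U"
      using V(1,3) by (intro exI[of _ "{i \<in> I. V i \<noteq> A}"]) auto
  qed
next
  assume R: ?R
  show ?L
  proof (subst openin_subopen, intro ballI)
    fix x assume x: "x \<in> U"
    with R obtain F where "finite F" "F \<subseteq> I" "cylinder I A F x \<subseteq> U" by blast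
    moreover have "x \<in> cylinder I A F x" using R x by (auto simp: cylinder_def)
    ultimately show "\<exists>V. openin (prodiscrete I A) V \<and> x \<in> V \<and> V \<subseteq> U"
      by (intro exI[of _ "cylinder I A F x"]) (simp add: openin_cylinder)
  qed
qed

lemma determined_by_imp_continuous_map:
  assumes det: "determined_by F (I \<rightarrow>\<^sub>E A) v" and F: "finite F" "F \<subseteq> I"
    and v: "v \<in> (I \<rightarrow>\<^sub>E A) \<rightarrow> D"
  shows "continuous_map (prodiscrete I A) (discrete_topology D) v"
  unfolding continuous_map_def
proof (intro conjI allI impI)
  show "v \<in> topspace (prodiscrete I A) \<rightarrow> topspace (discrete_topology D)"
    using v unfolding topspace_product_topology topspace_discrete_topology .
next
  fix U
  have "cylinder I A F x \<subseteq> {y \<in> I \<rightarrow>\<^sub>E A. v y \<in> U}" if x: "x \<in> I \<rightarrow>\<^sub>E A" "v x \<in> U" for x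
  proof
    fix y assume y: "y \<in> cylinder I A F x"
    have "v y = v x"
      by (rule determined_byD[OF det]) (use x(1) y in \<open>simp_all add: cylinder_def\<close>)
    then show "y \<in> {y \<in> I \<rightarrow>\<^sub>E A. v y \<in> U}" using x(2) y by (simp add: cylinder_def)
  qed
  then show "openin (prodiscrete I A) {x \<in> topspace (prodiscrete I A). v x \<in> U}"
    unfolding openin_prodiscrete_iff topspace_product_topology topspace_discrete_topology
    using F by blast
qed

lemma compact_space_prodiscrete: "finite A \<Longrightarrow> compact_space (prodiscrete I A)"
  by (simp add: compact_space_product_topology compact_space_discrete_topology)

lemma Hausdorff_space_prodiscrete: "Hausdorff_space (prodiscrete I A)"
  by (simp add: Hausdorff_space_product_topology)

lemma continuous_map_locally_constant_on_cylinder: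
  assumes v: "continuous_map (subtopology (prodiscrete I A) X) (discrete_topology D) v"
    and X: "X \<subseteq> I \<rightarrow>\<^sub>E A" and x: "x \<in> X"
  shows "\<exists>F. finite F \<and> F \<subseteq> I \<and> (\<forall>y \<in> X \<inter> cylinder I A F x. v y = v x)"
proof -
  have "v x \<in> D" using v x X by (simp add: continuous_map_def Pi_iff subset_iff)
  then have "openin (subtopology (prodiscrete I A) X) {y \<in> X. v y = v x}"
    using openin_continuous_map_preimage[OF v, of "{v x}"] X by (simp add: Int_absorb1)
  then obtain W where W: "openin (prodiscrete I A) W" "{y \<in> X. v y = v x} = W \<inter> X"
    by (auto simp: openin_subtopology)
  then obtain F where "finite F" "F \<subseteq> I" "cylinder I A F x \<subseteq> W"
    using x unfolding openin_prodiscrete_iff by blast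
  then show ?thesis using W(2) by blast
qed

lemma continuous_map_compactin_imp_determined_by:
  assumes X: "compactin (prodiscrete I A) X"
    and v: "continuous_map (subtopology (prodiscrete I A) X) (discrete_topology D) v"
  obtains T where "finite T" "T \<subseteq> I" "determined_by T X v"
proof -
  have XI: "X \<subseteq> I \<rightarrow>\<^sub>E A" using compactin_subset_topspace[OF X] by simp
  have "\<forall>x\<in>X. \<exists>F. finite F \<and> F \<subseteq> I \<and> (\<forall>y \<in> X \<inter> cylinder I A F x. v y = v x)"
    using continuous_map_locally_constant_on_cylinder[OF v XI] by blast
  then obtain F where F: "\<And>x. x \<in> X \<Longrightarrow> finite (F x)" "\<And>x. x \<in> X \<Longrightarrow> F x \<subseteq> I"
    "\<And>x y. \<lbrakk>x \<in> X; y \<in> X; y \<in> cylinder I A (F x) x\<rbrakk> \<Longrightarrow> v y = v x"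
    by (metis IntI)
  let ?\<U> = "(\<lambda>x. cylinder I A (F x) x) ` X"
  have cover: "X \<subseteq> \<Union>?\<U>" using XI by (auto simp: cylinder_def)
  have "\<exists>\<F>. finite \<F> \<and> \<F> \<subseteq> ?\<U> \<and> X \<subseteq> \<Union>\<F>"
    by (rule compactinD[OF X _ cover]) (use openin_cylinder[OF F(1,2)] in blast)
  then obtain \<F> where \<F>: "finite \<F>" "\<F> \<subseteq> ?\<U>" "X \<subseteq> \<Union>\<F>"
    by (elim exE conjE)
  from finite_subset_image[OF \<F>(1,2)] \<F>(3)
  obtain C where C: "C \<subseteq> X" "finite C" "X \<subseteq> (\<Union>x\<in>C. cylinder I A (F x) x)"
    by (elim exE conjE) simp
  show ?thesis
  proof (rule that)
    show "finite (\<Union>x\<in>C. F x)" using C(1,2) F(1) by blast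
    show "(\<Union>x\<in>C. F x) \<subseteq> I" using C(1) F(2) by blast
    show "determined_by (\<Union>x\<in>C. F x) X v"
    proof (rule determined_byI)
      fix x y assume xy: "x \<in> X" "y \<in> X" and eq: "\<And>t. t \<in> (\<Union>x\<in>C. F x) \<Longrightarrow> x t = y t"
      from C(3) xy(1) obtain c where c: "c \<in> C" "x \<in> cylinder I A (F c) c" by blast
      moreover have "\<forall>t\<in>F c. x t = y t" using eq c(1) by blast
      ultimately have "y \<in> cylinder I A (F c) c" using xy(2) XI by (auto simp: cylinder_def)
      moreover have "c \<in> X" using c(1) C(1) by blast
      ultimately show "v x = v y" using F(3)[of c x] F(3)[of c y] c(2) xy by simp
    qed
  qed
qed

lemma continuous_injective_inverse_determined_by:
  assumes A: "finite A" and f: "continuous_map (prodiscrete I A) (prodiscrete J B) f"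
    and inj: "inj_on f (I \<rightarrow>\<^sub>E A)" and i: "i \<in> I"
  obtains T where "finite T" "T \<subseteq> J"
    "determined_by T (f ` (I \<rightarrow>\<^sub>E A)) (\<lambda>y. inv_into (I \<rightarrow>\<^sub>E A) f y i)"
proof -
  let ?X = "prodiscrete I A" and ?K = "f ` (I \<rightarrow>\<^sub>E A)"
  let ?Y = "subtopology (prodiscrete J B) ?K"
  have KJ: "?K \<subseteq> J \<rightarrow>\<^sub>E B" using f by (auto simp: continuous_map_def)
  have K: "compactin (prodiscrete J B) ?K"
    using image_compactin[OF _ f] compact_space_prodiscrete[OF A, of I] by (simp add: compact_space_def)
  have "homeomorphic_map ?X ?Y f"
  proof (rule continuous_imp_homeomorphic_map)
    show "continuous_map ?X ?Y f" using f by (simp add: continuous_map_in_subtopology)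
    show "compact_space ?X" by (rule compact_space_prodiscrete[OF A])
    show "Hausdorff_space ?Y" by (intro Hausdorff_space_subtopology Hausdorff_space_prodiscrete)
  qed (use KJ inj in \<open>auto simp: Int_absorb1\<close>)
  then obtain g where g: "continuous_map ?Y ?X g" "\<And>x. x \<in> I \<rightarrow>\<^sub>E A \<Longrightarrow> g (f x) = x"
    by (auto simp: homeomorphic_map_maps homeomorphic_maps_def)
  have "continuous_map ?Y (discrete_topology A) (\<lambda>y. g y i)"
    using continuous_map_compose[OF g(1) continuous_map_product_projection[OF i]]
    by (simp add: comp_def)
  from continuous_map_compactin_imp_determined_by[OF K this]
  obtain T where T: "finite T" "T \<subseteq> J" "determined_by T ?K (\<lambda>y. g y i)" .
  have "inv_into (I \<rightarrow>\<^sub>E A) f y = g y" if "y \<in> ?K" for y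
    using that g(2) inj by auto
  then have "determined_by T ?K (\<lambda>y. inv_into (I \<rightarrow>\<^sub>E A) f y i)"
    using T(3) by (subst determined_by_cong) simp_all
  then show ?thesis using that T by blast
qed

section \<open>Equivariant maps and cellular automata\<close>

definition equivariant :: "('n, 'b) monoid_scheme \<Rightarrow> 'c set \<Rightarrow> (('n \<Rightarrow> 'c) \<Rightarrow> ('n \<Rightarrow> 'c)) \<Rightarrow> bool" where
  "equivariant N A \<tau> \<longleftrightarrow> \<tau> \<in> configs N A \<rightarrow> configs N A \<and>
     (\<forall>n\<in>carrier N. \<forall>x\<in>configs N A. \<tau> (shift N n x) = shift N n (\<tau> x))"

lemma configs_apply: "\<lbrakk>x \<in> configs N A; n \<in> carrier N\<rbrakk> \<Longrightarrow> x n \<in> A"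
  unfolding configs_def by (rule PiE_mem)

lemma equivariant_in_configs: "\<lbrakk>equivariant N A \<tau>; x \<in> configs N A\<rbrakk> \<Longrightarrow> \<tau> x \<in> configs N A"
  by (auto simp: equivariant_def)

lemma equivariant_id: "equivariant N A (\<lambda>x. x)"
  by (simp add: equivariant_def)

lemma equivariant_compose:
  "\<lbrakk>equivariant N A \<sigma>; equivariant N A \<tau>\<rbrakk> \<Longrightarrow> equivariant N A (\<lambda>x. \<sigma> (\<tau> x))"
  by (auto simp: equivariant_def)

context monoid
begin

lemma shift_in_configs:
  "\<lbrakk>n \<in> carrier G; x \<in> configs G A\<rbrakk> \<Longrightarrow> shift G n x \<in> configs G A"
  by (auto simp: shift_def configs_def PiE_iff)

lemma equivariant_apply:
  assumes "equivariant G A \<tau>" "n \<in> carrier G" "x \<in> configs G A"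
  shows "\<tau> x n = \<tau> (shift G n x) \<one>"
  using assms by (simp add: equivariant_def shift_def)

lemma equivariant_eq_iff:
  assumes \<tau>: "equivariant G A \<tau>" and \<sigma>: "equivariant G A \<sigma>"
  shows "(\<forall>x\<in>configs G A. \<tau> x = \<sigma> x) \<longleftrightarrow> (\<forall>x\<in>configs G A. \<tau> x \<one> = \<sigma> x \<one>)"
proof (intro iffI ballI)
  fix x assume eq: "\<forall>x\<in>configs G A. \<tau> x \<one> = \<sigma> x \<one>" and x: "x \<in> configs G A"
  have "\<tau> x \<in> carrier G \<rightarrow>\<^sub>E A" "\<sigma> x \<in> carrier G \<rightarrow>\<^sub>E A"
    using equivariant_in_configs[OF _ x] \<tau> \<sigma> by (auto simp: configs_def)
  then show "\<tau> x = \<sigma> x"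
  proof (rule PiE_ext)
    fix n assume n: "n \<in> carrier G"
    then show "\<tau> x n = \<sigma> x n"
      using eq shift_in_configs[OF n x]
      by (simp add: equivariant_apply[OF \<tau> n x] equivariant_apply[OF \<sigma> n x])
  qed
qed simp

lemma equivariant_determined_by_translate:
  assumes \<tau>: "equivariant G A \<tau>" and T: "determined_by T (configs G A) (\<lambda>x. \<tau> x \<one>)"
    "T \<subseteq> carrier G" and n: "n \<in> carrier G"
  shows "determined_by (T #> n) (configs G A) (\<lambda>x. \<tau> x n)"
proof (rule determined_byI)
  fix x y assume xy: "x \<in> configs G A" "y \<in> configs G A"
    and eq: "\<And>t. t \<in> T #> n \<Longrightarrow> x t = y t"
  have "\<tau> (shift G n x) \<one> = \<tau> (shift G n y) \<one>"
  proof (rule determined_byD[OF T(1)])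
    fix t assume "t \<in> T"
    then show "shift G n x t = shift G n y t"
      using eq T(2) n by (auto simp: shift_def r_coset_def)
  qed (use shift_in_configs n xy in auto)
  then show "\<tau> x n = \<tau> y n" using equivariant_apply[OF \<tau> n] xy by simp
qed

lemma cellular_automaton_iff:
  "cellular_automaton G A \<tau> \<longleftrightarrow> equivariant G A \<tau> \<and>
     (\<exists>T. finite T \<and> T \<subseteq> carrier G \<and> determined_by T (configs G A) (\<lambda>x. \<tau> x \<one>))"
proof (cases "equivariant G A \<tau>")
  case True
  then have maps: "\<tau> \<in> configs G A \<rightarrow> configs G A" by (simp add: equivariant_def)
  let ?memory = "\<lambda>E F. finite E \<and> E \<subseteq> carrier G \<and>
    (\<forall>x\<in>configs G A. \<forall>y\<in>configs G A. (\<forall>n\<in>E. x n = y n) \<longrightarrow> (\<forall>n\<in>F. \<tau> x n = \<tau> y n))"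
  have "cellular_automaton G A \<tau> \<longleftrightarrow> (\<forall>F. finite F \<and> F \<subseteq> carrier G \<longrightarrow> (\<exists>E. ?memory E F))"
    using True unfolding uniformly_continuous_prodiscrete_iff[OF maps, symmetric]
    by (simp add: cellular_automaton_def equivariant_def)
  also have "\<dots> \<longleftrightarrow> (\<exists>T. ?memory T {\<one>})"
  proof (intro iffI allI impI)
    assume "\<exists>T. ?memory T {\<one>}"
    then obtain T where T: "finite T" "T \<subseteq> carrier G"
      "determined_by T (configs G A) (\<lambda>x. \<tau> x \<one>)"
      by (auto simp: determined_by_def)
    fix F assume F: "finite F \<and> F \<subseteq> carrier G"
    show "\<exists>E. ?memory E F"
    proof (intro exI[of _ "T <#> F"] conjI ballI impI)
      show "finite (T <#> F)" using T(1) F by (simp add: set_mult_def)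
      show "T <#> F \<subseteq> carrier G" using T(2) F set_mult_closed by blast
      fix x y n assume xy: "x \<in> configs G A" "y \<in> configs G A"
        and eq: "\<forall>k\<in>T <#> F. x k = y k" and n: "n \<in> F"
      then have "determined_by (T #> n) (configs G A) (\<lambda>x. \<tau> x n)"
        using equivariant_determined_by_translate[OF True T(3,2)] F by blast
      moreover have "\<forall>k\<in>T #> n. x k = y k"
        using eq n by (auto simp: set_mult_def r_coset_def)
      ultimately show "\<tau> x n = \<tau> y n" using xy unfolding determined_by_def by blast
    qed
  qed (drule spec[of _ "{\<one>}"], simp)
  finally show ?thesis using True by (simp add: determined_by_def)
qed (auto simp: cellular_automaton_def equivariant_def)

lemma continuous_map_cellular_automaton:
  assumes "cellular_automaton G A \<tau>"
  shows "continuous_map (prodiscrete (carrier G) A) (prodiscrete (carrier G) A) \<tau>"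
proof -
  from assms obtain T where T: "finite T" "T \<subseteq> carrier G"
    "determined_by T (configs G A) (\<lambda>x. \<tau> x \<one>)" and \<tau>: "equivariant G A \<tau>"
    by (auto simp: cellular_automaton_iff)
  have maps: "\<tau> \<in> (carrier G \<rightarrow>\<^sub>E A) \<rightarrow> (carrier G \<rightarrow>\<^sub>E A)"
    using \<tau> by (simp add: equivariant_def configs_def)
  have "continuous_map (prodiscrete (carrier G) A) (discrete_topology A) (\<lambda>x. \<tau> x n)"
    if n: "n \<in> carrier G" for n
  proof (rule determined_by_imp_continuous_map)
    show "determined_by (T #> n) (carrier G \<rightarrow>\<^sub>E A) (\<lambda>x. \<tau> x n)"
      using equivariant_determined_by_translate[OF \<tau> T(3,2) n] by (simp add: configs_def)
    show "finite (T #> n)" using T(1) by (simp add: r_coset_def)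
    show "T #> n \<subseteq> carrier G" using T(2) n by (rule r_coset_subset_G)
    show "(\<lambda>x. \<tau> x n) \<in> (carrier G \<rightarrow>\<^sub>E A) \<rightarrow> A"
      using PiE_mem[OF funcset_mem[OF maps] n] by blast
  qed
  moreover have "\<tau> ` topspace (prodiscrete (carrier G) A) \<subseteq> extensional (carrier G)"
    using maps by (simp add: image_subset_iff Pi_iff PiE_iff)
  ultimately show ?thesis by (simp add: continuous_map_componentwise)
qed

end

section \<open>Local rules over a quotient\<close>

definition local_rule ::
    "('m, 'b) monoid_scheme \<Rightarrow> 'c set \<Rightarrow> 'm set \<Rightarrow> (('m \<Rightarrow> 'c) \<Rightarrow> 'c) \<Rightarrow> bool" where
  "local_rule M A S \<mu> \<longleftrightarrow> finite S \<and> S \<subseteq> carrier M \<and> \<mu> \<in> (S \<rightarrow>\<^sub>E A) \<rightarrow> A"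

definition invariant_patterns :: "('m \<Rightarrow> 'n) \<Rightarrow> 'm set \<Rightarrow> 'c set \<Rightarrow> ('m \<Rightarrow> 'c) set" where
  "invariant_patterns h P A = {p \<in> P \<rightarrow>\<^sub>E A. \<forall>m\<in>P. \<forall>m'\<in>P. h m = h m' \<longrightarrow> p m = p m'}"

locale monoid_epimorphism = M: monoid M + N: monoid N
  for M :: "('m, 'b) monoid_scheme" and N :: "('n, 'd) monoid_scheme" +
  fixes h :: "'m \<Rightarrow> 'n"
  assumes hom: "h \<in> hom M N" and surj: "h ` carrier M = carrier N"
begin

lemma h_closed: "m \<in> carrier M \<Longrightarrow> h m \<in> carrier N"
  using surj by blast

lemma h_mult: "\<lbrakk>m \<in> carrier M; m' \<in> carrier M\<rbrakk> \<Longrightarrow> h (m \<otimes>\<^bsub>M\<^esub> m') = h m \<otimes>\<^bsub>N\<^esub> h m'"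
  by (rule hom_mult[OF hom])

lemma h_one: "h \<one>\<^bsub>M\<^esub> = \<one>\<^bsub>N\<^esub>"
proof -
  obtain m where m: "m \<in> carrier M" "h m = \<one>\<^bsub>N\<^esub>" using surj N.one_closed by (metis imageE)
  have "h \<one>\<^bsub>M\<^esub> = h \<one>\<^bsub>M\<^esub> \<otimes>\<^bsub>N\<^esub> h m" using m h_closed by simp
  also have "\<dots> = h m" using h_mult[of "\<one>\<^bsub>M\<^esub>" m] m(1) by simp
  finally show ?thesis using m(2) by simp
qed

text \<open>Memory sets are taken in \<open>M\<close> rather than in \<open>N\<close>, so that one pair of rules can be used for all
  quotients of \<open>M\<close> at once.\<close>

definition automaton :: "'m set \<Rightarrow> (('m \<Rightarrow> 'c) \<Rightarrow> 'c) \<Rightarrow> ('n \<Rightarrow> 'c) \<Rightarrow> ('n \<Rightarrow> 'c)" where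
  "automaton S \<mu> x = (\<lambda>n\<in>carrier N. \<mu> (\<lambda>s\<in>S. x (h s \<otimes>\<^bsub>N\<^esub> n)))"

lemma automaton_at:
  assumes S: "S \<subseteq> carrier M" and m: "m \<in> carrier M"
  shows "automaton S \<mu> x (h m) = \<mu> (\<lambda>s\<in>S. x (h (s \<otimes>\<^bsub>M\<^esub> m)))"
proof -
  have "(\<lambda>s\<in>S. x (h s \<otimes>\<^bsub>N\<^esub> h m)) = (\<lambda>s\<in>S. x (h (s \<otimes>\<^bsub>M\<^esub> m)))"
    using S by (intro restrict_ext) (simp add: h_mult m subset_iff)
  then show ?thesis by (simp add: automaton_def h_closed[OF m])
qed

lemma automaton_at_one:
  assumes "S \<subseteq> carrier M"
  shows "automaton S \<mu> x \<one>\<^bsub>N\<^esub> = \<mu> (\<lambda>s\<in>S. x (h s))"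
proof -
  have "(\<lambda>s\<in>S. x (h (s \<otimes>\<^bsub>M\<^esub> \<one>\<^bsub>M\<^esub>))) = (\<lambda>s\<in>S. x (h s))"
    using assms by (intro restrict_ext) auto
  then show ?thesis using automaton_at[OF assms M.one_closed, of \<mu> x] by (simp add: h_one)
qed

lemma automaton_automaton_at_one:
  assumes "S \<subseteq> carrier M" "T \<subseteq> carrier M"
  shows "automaton T \<nu> (automaton S \<mu> x) \<one>\<^bsub>N\<^esub> =
    \<nu> (\<lambda>t\<in>T. \<mu> (\<lambda>s\<in>S. x (h (s \<otimes>\<^bsub>M\<^esub> t))))"
proof -
  have "(\<lambda>t\<in>T. automaton S \<mu> x (h t)) = (\<lambda>t\<in>T. \<mu> (\<lambda>s\<in>S. x (h (s \<otimes>\<^bsub>M\<^esub> t))))"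
    using assms by (intro restrict_ext automaton_at) auto
  then show ?thesis by (simp add: automaton_at_one[OF assms(2)])
qed

lemma equivariant_automaton:
  assumes "local_rule M A S \<mu>"
  shows "equivariant N A (automaton S \<mu>)"
  unfolding equivariant_def
proof (intro conjI ballI)
  have S: "h s \<in> carrier N" if "s \<in> S" for s
    using assms that h_closed by (auto simp: local_rule_def)
  show "automaton S \<mu> \<in> configs N A \<rightarrow> configs N A"
  proof
    fix x assume "x \<in> configs N A"
    then have "(\<lambda>s\<in>S. x (h s \<otimes>\<^bsub>N\<^esub> n)) \<in> S \<rightarrow>\<^sub>E A" if "n \<in> carrier N" for n
      using that S by (auto intro: configs_apply)
    then have "\<mu> (\<lambda>s\<in>S. x (h s \<otimes>\<^bsub>N\<^esub> n)) \<in> A" if "n \<in> carrier N" for n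
      using that assms unfolding local_rule_def by blast
    then show "automaton S \<mu> x \<in> configs N A"
      by (simp add: automaton_def configs_def)
  qed
  fix n x assume n: "n \<in> carrier N" and "x \<in> configs N A"
  have "(\<lambda>s\<in>S. shift N n x (h s \<otimes>\<^bsub>N\<^esub> k)) = (\<lambda>s\<in>S. x (h s \<otimes>\<^bsub>N\<^esub> (k \<otimes>\<^bsub>N\<^esub> n)))"
    if "k \<in> carrier N" for k
    using that n S by (intro restrict_ext) (simp add: shift_def N.m_assoc)
  then show "automaton S \<mu> (shift N n x) = shift N n (automaton S \<mu> x)"
    using n by (auto simp: automaton_def shift_def)
qed

lemma cellular_automaton_automaton:
  assumes \<mu>: "local_rule M A S \<mu>"
  shows "cellular_automaton N A (automaton S \<mu>)"
proof -
  have S: "finite S" "S \<subseteq> carrier M" using \<mu> by (auto simp: local_rule_def)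
  have "determined_by (h ` S) (configs N A) (\<lambda>x. automaton S \<mu> x \<one>\<^bsub>N\<^esub>)"
    unfolding automaton_at_one[OF S(2)]
    by (intro determined_byI arg_cong[of _ _ \<mu>] restrict_ext) blast
  moreover have "finite (h ` S)" "h ` S \<subseteq> carrier N" using S h_closed by auto
  ultimately show ?thesis
    unfolding N.cellular_automaton_iff using equivariant_automaton[OF \<mu>] by blast
qed

lemma cellular_automaton_eq_automaton:
  assumes \<tau>: "cellular_automaton N A \<tau>" and A: "A \<noteq> {}"
  obtains S \<mu> where "local_rule M A S \<mu>" "\<And>x. x \<in> configs N A \<Longrightarrow> \<tau> x = automaton S \<mu> x"
proof -
  from \<tau> obtain T where T: "finite T" "T \<subseteq> h ` carrier M"
    "determined_by T (configs N A) (\<lambda>x. \<tau> x \<one>\<^bsub>N\<^esub>)" and eqv: "equivariant N A \<tau>"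
    by (auto simp: N.cellular_automaton_iff surj)
  have "(\<lambda>x. \<tau> x \<one>\<^bsub>N\<^esub>) \<in> configs N A \<rightarrow> A"
    using configs_apply[OF equivariant_in_configs[OF eqv] N.one_closed] by blast
  from determined_by_factorization[OF T(3,1,2) this A]
  obtain S \<mu> where S: "finite S" "S \<subseteq> carrier M" "\<mu> \<in> (S \<rightarrow>\<^sub>E A) \<rightarrow> A"
    and \<mu>: "\<And>x. x \<in> configs N A \<Longrightarrow> \<tau> x \<one>\<^bsub>N\<^esub> = \<mu> (\<lambda>s\<in>S. x (h s))" by blast
  have rule: "local_rule M A S \<mu>" using S by (simp add: local_rule_def)
  have "\<forall>x\<in>configs N A. \<tau> x = automaton S \<mu> x"
    unfolding N.equivariant_eq_iff[OF eqv equivariant_automaton[OF rule]]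
    using \<mu> by (simp add: automaton_at_one[OF S(2)])
  then show ?thesis using that rule by blast
qed

lemma injective_cellular_automaton_left_inverse:
  assumes \<tau>: "cellular_automaton N A \<tau>" and inj: "inj_on \<tau> (configs N A)"
    and A: "finite A" "A \<noteq> {}"
  obtains T \<nu> where "local_rule M A T \<nu>" "\<And>x. x \<in> configs N A \<Longrightarrow> automaton T \<nu> (\<tau> x) = x"
proof -
  let ?X = "configs N A"
  from continuous_injective_inverse_determined_by[OF A(1)
      N.continuous_map_cellular_automaton[OF \<tau>] inj[unfolded configs_def] N.one_closed]
  obtain E where E: "finite E" "E \<subseteq> h ` carrier M"
    "determined_by E (\<tau> ` ?X) (\<lambda>y. inv_into ?X \<tau> y \<one>\<^bsub>N\<^esub>)"
    unfolding configs_def surj .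
  have "(\<lambda>y. inv_into ?X \<tau> y \<one>\<^bsub>N\<^esub>) \<in> \<tau> ` ?X \<rightarrow> A"
    by (auto simp: inj configs_apply)
  from determined_by_factorization[OF E(3,1,2) this A(2)]
  obtain T \<nu> where T: "finite T" "T \<subseteq> carrier M" "\<nu> \<in> (T \<rightarrow>\<^sub>E A) \<rightarrow> A"
    and \<nu>: "\<And>y. y \<in> \<tau> ` ?X \<Longrightarrow> inv_into ?X \<tau> y \<one>\<^bsub>N\<^esub> = \<nu> (\<lambda>t\<in>T. y (h t))" by blast
  have rule: "local_rule M A T \<nu>" using T by (simp add: local_rule_def)
  have "equivariant N A \<tau>" using \<tau> by (simp add: N.cellular_automaton_iff)
  then have eqv: "equivariant N A (\<lambda>x. automaton T \<nu> (\<tau> x))"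
    by (rule equivariant_compose[OF equivariant_automaton[OF rule]])
  have "\<forall>x\<in>?X. automaton T \<nu> (\<tau> x) = x"
    unfolding N.equivariant_eq_iff[OF eqv equivariant_id]
    using \<nu> inj by (auto simp: automaton_at_one[OF T(2)] simp flip: \<nu>)
  then show ?thesis using that rule by blast
qed

section \<open>Finite witnesses of failure of surjunctivity\<close>

lemma not_surjunctive_iff:
  "\<not> surjunctive N \<longleftrightarrow> (\<exists>(A :: nat set) S \<mu> T \<nu>. finite A \<and> local_rule M A S \<mu> \<and> local_rule M A T \<nu> \<and>
     (\<forall>x\<in>configs N A. automaton T \<nu> (automaton S \<mu> x) = x) \<and>
     \<not> (\<forall>x\<in>configs N A. automaton S \<mu> (automaton T \<nu> x) = x))"
    (is "_ \<longleftrightarrow> (\<exists>A S \<mu> T \<nu>. ?witness A S \<mu> T \<nu>)")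
proof
  assume "\<not> surjunctive N"
  then obtain A :: "nat set" and \<tau> where fin: "finite A" and ca: "cellular_automaton N A \<tau>"
    and inj: "inj_on \<tau> (configs N A)" and nsurj: "\<tau> ` configs N A \<noteq> configs N A"
    unfolding surjunctive_def by blast
  have \<tau>: "\<tau> x \<in> configs N A" if "x \<in> configs N A" for x
    using ca that by (auto simp: cellular_automaton_def)
  then obtain y where y: "y \<in> configs N A" "y \<notin> \<tau> ` configs N A" using nsurj by blast
  then have A: "A \<noteq> {}" by (auto simp: configs_def PiE_iff)
  obtain S \<mu> where \<mu>: "local_rule M A S \<mu>" "\<And>x. x \<in> configs N A \<Longrightarrow> \<tau> x = automaton S \<mu> x"
    using cellular_automaton_eq_automaton[OF ca A] by blast
  obtain T \<nu> where \<nu>: "local_rule M A T \<nu>" "\<And>x. x \<in> configs N A \<Longrightarrow> automaton T \<nu> (\<tau> x) = x"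
    using injective_cellular_automaton_left_inverse[OF ca inj fin A] by blast
  have "automaton T \<nu> y \<in> configs N A"
    by (rule equivariant_in_configs[OF equivariant_automaton[OF \<nu>(1)] y(1)])
  then have "automaton S \<mu> (automaton T \<nu> y) \<noteq> y" using y(2) \<mu>(2) by (metis imageI)
  moreover have "automaton T \<nu> (automaton S \<mu> x) = x" if "x \<in> configs N A" for x
    using that \<mu>(2) \<nu>(2) by metis
  ultimately show "\<exists>A S \<mu> T \<nu>. ?witness A S \<mu> T \<nu>" using fin \<mu>(1) \<nu>(1) y(1) by blast
next
  assume "\<exists>A S \<mu> T \<nu>. ?witness A S \<mu> T \<nu>"
  then obtain A S \<mu> T \<nu> where w: "?witness A S \<mu> T \<nu>" by blast
  then have "cellular_automaton N A (automaton S \<mu>)" by (simp add: cellular_automaton_automaton)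
  moreover have "inj_on (automaton S \<mu>) (configs N A)" using w by (metis inj_onI)
  moreover have "automaton S \<mu> ` configs N A \<noteq> configs N A" using w by (metis imageE)
  ultimately show "\<not> surjunctive N" using w unfolding surjunctive_def by blast
qed

lemma invariant_patterns_eq_image:
  assumes P: "P \<subseteq> carrier M" "P \<noteq> {}"
  shows "(\<lambda>x. \<lambda>m\<in>P. x (h m)) ` configs N A = invariant_patterns h P A"
proof (intro equalityI subsetI)
  fix p assume "p \<in> (\<lambda>x. \<lambda>m\<in>P. x (h m)) ` configs N A"
  then obtain x where x: "x \<in> configs N A" and p: "p = (\<lambda>m\<in>P. x (h m))" by blast
  have "x (h m) \<in> A" if "m \<in> P" for m
    using configs_apply[OF x h_closed] that P(1) by blast
  then show "p \<in> invariant_patterns h P A" by (simp add: p invariant_patterns_def)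
next
  fix p assume p: "p \<in> invariant_patterns h P A"
  then have "\<forall>m m'. m \<in> P \<and> m' \<in> P \<and> h m = h m' \<longrightarrow> p m = p m'"
    by (simp add: invariant_patterns_def)
  then obtain q where q: "\<forall>m. m \<in> P \<longrightarrow> p m = q (h m)"
    unfolding function_factors_left_gen by (elim exE)
  obtain m\<^sub>0 where m\<^sub>0: "m\<^sub>0 \<in> P" using P(2) by blast
  define x where "x = (\<lambda>n\<in>carrier N. if n \<in> h ` P then q n else p m\<^sub>0)"
  have pA: "p \<in> P \<rightarrow>\<^sub>E A" using p by (simp add: invariant_patterns_def)
  have "q n \<in> A" if "n \<in> h ` P" for n using that q pA by (metis PiE_mem imageE)
  then have "x \<in> configs N A" using PiE_mem[OF pA m\<^sub>0] by (simp add: x_def configs_def)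
  moreover have "p = (\<lambda>m\<in>P. x (h m))"
  proof (rule PiE_ext[OF pA])
    show "(\<lambda>m\<in>P. x (h m)) \<in> P \<rightarrow>\<^sub>E A"
      using configs_apply[OF \<open>x \<in> configs N A\<close> h_closed] P(1) by auto
    show "p m = (\<lambda>m\<in>P. x (h m)) m" if "m \<in> P" for m
      using that q P(1) h_closed by (auto simp: x_def)
  qed
  ultimately show "p \<in> (\<lambda>x. \<lambda>m\<in>P. x (h m)) ` configs N A" by blast
qed

lemma automaton_left_inverse_iff:
  assumes \<mu>: "local_rule M A S \<mu>" and \<nu>: "local_rule M A T \<nu>"
    and P: "P \<subseteq> carrier M" "\<one>\<^bsub>M\<^esub> \<in> P" "S <#>\<^bsub>M\<^esub> T \<subseteq> P"
  shows "(\<forall>x\<in>configs N A. automaton T \<nu> (automaton S \<mu> x) = x) \<longleftrightarrow>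
    (\<forall>p\<in>invariant_patterns h P A. \<nu> (\<lambda>t\<in>T. \<mu> (\<lambda>s\<in>S. p (s \<otimes>\<^bsub>M\<^esub> t))) = p \<one>\<^bsub>M\<^esub>)"
proof -
  let ?local = "\<lambda>p. \<nu> (\<lambda>t\<in>T. \<mu> (\<lambda>s\<in>S. p (s \<otimes>\<^bsub>M\<^esub> t)))"
  have ST: "S \<subseteq> carrier M" "T \<subseteq> carrier M" using \<mu> \<nu> by (auto simp: local_rule_def)
  have local_restrict: "?local (\<lambda>m\<in>P. x (h m)) = ?local (\<lambda>m. x (h m))" for x
    using P(3) by (intro arg_cong[of _ _ \<nu>] arg_cong[of _ _ \<mu>] restrict_ext) (auto simp: set_mult_def)
  have "(\<forall>x\<in>configs N A. automaton T \<nu> (automaton S \<mu> x) = x) \<longleftrightarrow>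
      (\<forall>x\<in>configs N A. automaton T \<nu> (automaton S \<mu> x) \<one>\<^bsub>N\<^esub> = x \<one>\<^bsub>N\<^esub>)"
    by (rule N.equivariant_eq_iff[OF equivariant_compose[OF equivariant_automaton[OF \<nu>]
          equivariant_automaton[OF \<mu>]] equivariant_id])
  also have "\<dots> \<longleftrightarrow> (\<forall>x\<in>configs N A. ?local (\<lambda>m\<in>P. x (h m)) = (\<lambda>m\<in>P. x (h m)) \<one>\<^bsub>M\<^esub>)"
    by (simp only: automaton_automaton_at_one[OF ST] local_restrict restrict_apply' P(2) h_one)
  also have "\<dots> \<longleftrightarrow> (\<forall>p\<in>invariant_patterns h P A. ?local p = p \<one>\<^bsub>M\<^esub>)"
    using P(1,2) by (subst invariant_patterns_eq_image[symmetric]) auto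
  finally show ?thesis .
qed

lemma not_surjunctive_finitely_detected:
  assumes "\<not> surjunctive N"
  obtains P where "finite P" "P \<subseteq> carrier M"
    "\<And>(N' :: ('k, 'e) monoid_scheme) h'. \<lbrakk>monoid_epimorphism M N' h';
       \<And>m m'. \<lbrakk>m \<in> P; m' \<in> P\<rbrakk> \<Longrightarrow> h m = h m' \<longleftrightarrow> h' m = h' m'\<rbrakk> \<Longrightarrow> \<not> surjunctive N'"
proof -
  from assms obtain A :: "nat set" and S \<mu> T \<nu> where A: "finite A"
    and \<mu>: "local_rule M A S \<mu>" and \<nu>: "local_rule M A T \<nu>"
    and left: "\<forall>x\<in>configs N A. automaton T \<nu> (automaton S \<mu> x) = x"
    and not_right: "\<not> (\<forall>x\<in>configs N A. automaton S \<mu> (automaton T \<nu> x) = x)"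
    unfolding not_surjunctive_iff by blast
  define P where "P = insert \<one>\<^bsub>M\<^esub> ((S <#>\<^bsub>M\<^esub> T) \<union> (T <#>\<^bsub>M\<^esub> S))"
  have "finite S" "finite T" "S \<subseteq> carrier M" "T \<subseteq> carrier M"
    using \<mu> \<nu> by (auto simp: local_rule_def)
  then have finP: "finite P" and PM: "P \<subseteq> carrier M"
    by (auto simp: P_def set_mult_def)
  have P: "\<one>\<^bsub>M\<^esub> \<in> P" "S <#>\<^bsub>M\<^esub> T \<subseteq> P" "T <#>\<^bsub>M\<^esub> S \<subseteq> P" by (auto simp: P_def)
  show ?thesis
  proof (rule that[OF finP PM])
    fix N' :: "('k, 'e) monoid_scheme" and h'
    assume epi: "monoid_epimorphism M N' h'"
      and eq: "\<And>m m'. \<lbrakk>m \<in> P; m' \<in> P\<rbrakk> \<Longrightarrow> h m = h m' \<longleftrightarrow> h' m = h' m'"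
    interpret N': monoid_epimorphism M N' h' by (fact epi)
    have "invariant_patterns h P A = invariant_patterns h' P A"
      using eq by (simp add: invariant_patterns_def)
    then have "\<forall>x\<in>configs N' A. N'.automaton T \<nu> (N'.automaton S \<mu> x) = x"
      "\<not> (\<forall>x\<in>configs N' A. N'.automaton S \<mu> (N'.automaton T \<nu> x) = x)"
      using left not_right
      unfolding automaton_left_inverse_iff[OF \<mu> \<nu> PM P(1,2)]
        automaton_left_inverse_iff[OF \<nu> \<mu> PM P(1,3)]
        N'.automaton_left_inverse_iff[OF \<mu> \<nu> PM P(1,2)]
        N'.automaton_left_inverse_iff[OF \<nu> \<mu> PM P(1,3)]
      by simp_all
    then show "\<not> surjunctive N'"
      unfolding N'.not_surjunctive_iff using A \<mu> \<nu> by blast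
  qed
qed

end

lemma monoid_epimorphism_quotient_monoid:
  assumes M: "monoid M" and \<gamma>: "congruence_on M \<gamma>"
  shows "monoid_epimorphism M (quotient_monoid M \<gamma>) (\<lambda>m. \<gamma> `` {m})"
proof -
  have surj: "(\<lambda>m. \<gamma> `` {m}) ` carrier M = carrier (quotient_monoid M \<gamma>)"
    by (auto simp: quotient_monoid_def quotient_def)
  then have "(\<lambda>m. \<gamma> `` {m}) \<in> hom M (quotient_monoid M \<gamma>)"
    by (intro homI) (auto simp: quotient_monoid_mult[OF \<gamma>])
  then show ?thesis
    using surj M monoid_quotient_monoid[OF M \<gamma>]
    by (simp add: monoid_epimorphism_def monoid_epimorphism_axioms_def)
qed

lemma congruence_class_eq_iff:
  "\<lbrakk>congruence_on M \<gamma>; m \<in> carrier M; m' \<in> carrier M\<rbrakk> \<Longrightarrow> \<gamma> `` {m} = \<gamma> `` {m'} \<longleftrightarrow> (m, m') \<in> \<gamma>"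
  unfolding congruence_on_def by (elim conjE) (rule eq_equiv_class_iff)

lemma openin_not_surjunctive_quotient:
  assumes M: "monoid M"
  shows "openin (congruence_space M)
    {\<gamma> \<in> congruences M. \<not> surjunctive (quotient_monoid M \<gamma>)}" (is "openin _ ?U")
  unfolding openin_congruence_space
proof (intro conjI ballI)
  note epi = monoid_epimorphism_quotient_monoid[OF M]
  fix \<gamma> assume "\<gamma> \<in> ?U"
  then have \<gamma>: "congruence_on M \<gamma>" and ns: "\<not> surjunctive (quotient_monoid M \<gamma>)"
    by (auto simp: congruences_def)
  obtain P where P: "finite P" "P \<subseteq> carrier M"
    and detect: "\<And>(N :: 'a set monoid) h. \<lbrakk>monoid_epimorphism M N h;
      \<And>m m'. \<lbrakk>m \<in> P; m' \<in> P\<rbrakk> \<Longrightarrow> \<gamma> `` {m} = \<gamma> `` {m'} \<longleftrightarrow> h m = h m'\<rbrakk> \<Longrightarrow> \<not> surjunctive N"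
    using monoid_epimorphism.not_surjunctive_finitely_detected[OF epi[OF \<gamma>] ns] by metis
  have "\<not> surjunctive (quotient_monoid M \<delta>)"
    if \<delta>: "congruence_on M \<delta>" and eq: "\<gamma> \<inter> P \<times> P = \<delta> \<inter> P \<times> P" for \<delta>
  proof (rule detect[OF epi[OF \<delta>]])
    fix m m' assume "m \<in> P" "m' \<in> P"
    then have "m \<in> carrier M" "m' \<in> carrier M" "(m, m') \<in> \<gamma> \<longleftrightarrow> (m, m') \<in> \<delta>"
      using P(2) eq by blast+
    then show "\<gamma> `` {m} = \<gamma> `` {m'} \<longleftrightarrow> \<delta> `` {m} = \<delta> `` {m'}"
      by (simp add: congruence_class_eq_iff[OF \<gamma>] congruence_class_eq_iff[OF \<delta>])
  qed
  then show "\<exists>F. finite F \<and> F \<subseteq> carrier M \<times> carrier M \<and>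
      (\<forall>\<delta>\<in>congruences M. \<gamma> \<inter> F = \<delta> \<inter> F \<longrightarrow> \<delta> \<in> ?U)"
    using P by (intro exI[of _ "P \<times> P"]) (auto simp: congruences_def)
qed blast

theorem theorem6p10:
  fixes M :: "('a, 'b) monoid_scheme"
  assumes "monoid M"
  shows "closedin (congruence_space M)
           {\<gamma> \<in> congruences M. surjunctive (quotient_monoid M \<gamma>)}"
proof -
  have "congruences M - {\<gamma> \<in> congruences M. surjunctive (quotient_monoid M \<gamma>)} =
      {\<gamma> \<in> congruences M. \<not> surjunctive (quotient_monoid M \<gamma>)}"
    by blast
  then show ?thesis
    using openin_not_surjunctive_quotient[OF assms]
    by (simp add: closedin_def topspace_congruence_space)
qed

end
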